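(* Let $\eta \in \Omega$ be a stable sandpile and let $A \subseteq V$ be a generator in $\eta$. Then, for any choices made in its step 4, the recursive Algorithm $\mathrm{ALG}(\eta,A)$ described in the context terminates, and its output equals $\mathbb{E}[X(\eta)\mid Y \in A]$.
   Context: Fix an integer $L\ge 1$ and let $V=\{1,\ldots,L\}^2\subset\mathbb{Z}^2$, labelled $V=\{v_1,\ldots,v_{L^2}\}$. For $v,w\in V$ write $v\sim w$ if $v,w$ are nearest neighbours in $\mathbb{Z}^2$; connectedness of subsets of $V$ refers to this relation. All vertices of $\mathbb{Z}^2\setminus V$ are identified with a single sink; every $v\in V$ has four edges to its lattice neighbours, those leading outside $V$ going to the sink (grains sent there are discarded). A sandpile is a map $\eta:V\to\mathbb{Z}$; $\mathcal{X}$ is the set of all sandpiles. $\Omega\subset\mathcal{X}$ is the set of stable sandpiles, i.e. those with $0\le\eta(v)<4$ for all $v\in V$. A vertex $v$ is critical in $\eta$ if $\eta(v)=3$. A generator in $\eta$ is a connected component (maximal connected set) of the set of critical vertices of $\eta$. Toppling a vertex $v\in V$ decreases $\eta(v)$ by $4$ and increases $\eta(w)$ by $1$ for each $w\in V$ with $w\sim v$; the toppling is legal if $\eta(v)>3$. Avalanche size: for $\eta\in\Omega$ and $v\in V$, $x(\eta,v)$ is the total number of topplings (counted with multiplicity) in any sequence of legal topplings that starts at the configuration obtained from $\eta$ by adding one grain at $v$ and ends at a stable configuration; this number is finite and independent of the sequence. $Y$ is uniformly distributed on $V$ (the vertex where the next grain lands) and $X(\eta)=x(\eta,Y)$, so for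 nonempty $B\subseteq V$, $\mathbb{E}[X(\eta)\mid Y\in B]=\frac{1}{|B|}\sum_{v\in B}x(\eta,v)$. Algorithm $\mathrm{ALG}(\eta,A)$. Input: a configuration $\eta:V\to\mathbb{Z}$ and a set $A\subseteq V$ (initially $\eta\in\Omega$ and $A$ a generator in $\eta$; in recursive calls, $A$ is a connected set of vertices on which the current configuration equals $3$). 1. Initialize a directed graph with no edges, $E=\emptyset$. Let $\mathrm{indeg}(v)$, $\mathrm{outdeg}(v)$ denote the current indegree and outdegree of $v\in V$. 2. For each $v\in A$, add to $E$ directed edges from $v$ to each of its four lattice neighbours (edges leading outside $V$ go to the sink and are counted with multiplicity, so that $\mathrm{outdeg}(v)=4$ afterwards). 3. Set $w'=|A|$. 4. While there is a $v\in V\setminus A$ with $\eta(v)+\mathrm{indeg}(v)-\mathrm{outdeg}(v)\ge 4$: select an arbitrary such $v$, add to $E$ directed edges from $v$ to each of its four lattice neighbours (same convention as in step 2), and increment $w'$ by $1$. 5. For each $v\in V$, set $\eta'(v)=\eta(v)+\mathrm{indeg}(v)-\mathrm{outdeg}(v)$. 6. If $\{v\in A:\eta'(v)=3\}$ is nonempty, let $a_1,\ldots,a_\ell$ be its connected components (with respect to the lattice), let $z_i$ be the output of $\mathrm{ALG}(\eta',a_i)$ for $i=1,\ldots,\ell$, and set $w=w'+\sum_{i=1}^{\ell}\frac{|a_i|}{|A|}z_i$. Otherwise set $w=w'$. 7. Output $w$. *)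

theory Defs
  imports "HOL-Probability.Probability" "HOL-Library.Multiset"
begin

type_synonym vertex = "int \<times> int"

text \<open>
  A sandpile on the grid is a total function on the lattice of which only the values on the grid
  matter; toppling never changes the values outside the grid.
\<close>
type_synonym sandpile = "vertex \<Rightarrow> int"

definition grid :: "nat \<Rightarrow> vertex set" where
  "grid L = {1..int L} \<times> {1..int L}"

definition nbrs :: "vertex \<Rightarrow> vertex set" where
  "nbrs v = (case v of (i, j) \<Rightarrow> {(i + 1, j), (i - 1, j), (i, j + 1), (i, j - 1)})"

definition lattice_connected :: "vertex set \<Rightarrow> bool" where
  "lattice_connected S \<longleftrightarrow>
     S \<noteq> {} \<and> (\<forall>u\<in>S. \<forall>v\<in>S. (\<lambda>x y. x \<in> S \<and> y \<in> S \<and> y \<in> nbrs x)\<^sup>*\<^sup>* u v)"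

definition lattice_components :: "vertex set \<Rightarrow> vertex set set" where
  "lattice_components S =
     {C. C \<subseteq> S \<and> lattice_connected C \<and>
         (\<forall>D. D \<subseteq> S \<and> lattice_connected D \<and> C \<subseteq> D \<longrightarrow> D = C)}"

definition stable_sandpiles :: "nat \<Rightarrow> sandpile set" where
  "stable_sandpiles L = {\<eta>. \<forall>v\<in>grid L. 0 \<le> \<eta> v \<and> \<eta> v < 4}"

definition critical :: "sandpile \<Rightarrow> vertex \<Rightarrow> bool" where
  "critical \<eta> v \<longleftrightarrow> \<eta> v = 3"

definition generators :: "nat \<Rightarrow> sandpile \<Rightarrow> vertex set set" where
  "generators L \<eta> = lattice_components {v \<in> grid L. critical \<eta> v}"

definition topple :: "nat \<Rightarrow> vertex \<Rightarrow> sandpile \<Rightarrow> sandpile" where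
  "topple L v \<eta> =
     (\<lambda>w. if w = v then \<eta> w - 4 else if w \<in> grid L \<inter> nbrs v then \<eta> w + 1 else \<eta> w)"

definition legal_toppling :: "nat \<Rightarrow> sandpile \<Rightarrow> sandpile \<Rightarrow> bool" where
  "legal_toppling L \<eta> \<eta>' \<longleftrightarrow> (\<exists>v\<in>grid L. \<eta> v > 3 \<and> \<eta>' = topple L v \<eta>)"

definition add_grain :: "vertex \<Rightarrow> sandpile \<Rightarrow> sandpile" where
  "add_grain v \<eta> = \<eta>(v := \<eta> v + 1)"

text \<open>
  The description is proper: the number of topplings until stability exists and does not depend
  on the sequence of legal topplings.
\<close>
definition avalanche_size :: "nat \<Rightarrow> sandpile \<Rightarrow> vertex \<Rightarrow> nat" where
  "avalanche_size L \<eta> v =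
     (THE n. \<exists>\<eta>'\<in>stable_sandpiles L. (legal_toppling L ^^ n) (add_grain v \<eta>) \<eta>')"

text \<open>
  Conditional expectation of the avalanche size given that the uniformly distributed landing
  vertex lies in \<open>B\<close>, for \<open>B\<close> meeting the grid.
\<close>
definition expected_avalanche_size :: "nat \<Rightarrow> sandpile \<Rightarrow> vertex set \<Rightarrow> real" where
  "expected_avalanche_size L \<eta> B =
     measure_pmf.expectation (cond_pmf (pmf_of_set (grid L)) B)
       (\<lambda>v. real (avalanche_size L \<eta> v))"

text \<open>
  The edges form a multiset of (source, target) pairs, where the target \<open>None\<close> is the sink.
\<close>
type_synonym edges = "(vertex \<times> vertex option) multiset"

definition out_edges :: "nat \<Rightarrow> vertex \<Rightarrow> edges" where
  "out_edges L v =
     image_mset (\<lambda>w. (v, if w \<in> grid L then Some w else None)) (mset_set (nbrs v))"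

definition indeg :: "edges \<Rightarrow> vertex \<Rightarrow> nat" where
  "indeg E v = size {# e \<in># E. snd e = Some v #}"

definition outdeg :: "edges \<Rightarrow> vertex \<Rightarrow> nat" where
  "outdeg E v = size {# e \<in># E. fst e = v #}"

definition current :: "nat \<Rightarrow> sandpile \<Rightarrow> edges \<Rightarrow> sandpile" where
  "current L \<eta> E =
     (\<lambda>v. if v \<in> grid L then \<eta> v + int (indeg E v) - int (outdeg E v) else \<eta> v)"

text \<open>A state of the while loop consists of the edges \<open>E\<close> and the counter \<open>w'\<close>.\<close>
type_synonym loop_state = "edges \<times> nat"

definition loop_init :: "nat \<Rightarrow> vertex set \<Rightarrow> loop_state" where
  "loop_init L A = ((\<Sum>v\<in>A. out_edges L v), card A)"

definition selectable :: "nat \<Rightarrow> sandpile \<Rightarrow> vertex set \<Rightarrow> edges \<Rightarrow> vertex set" where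
  "selectable L \<eta> A E = {v \<in> grid L - A. current L \<eta> E v \<ge> 4}"

definition loop_step ::
    "nat \<Rightarrow> sandpile \<Rightarrow> vertex set \<Rightarrow> loop_state \<Rightarrow> loop_state \<Rightarrow> bool" where
  "loop_step L \<eta> A s s' \<longleftrightarrow>
     (\<exists>v\<in>selectable L \<eta> A (fst s). s' = (fst s + out_edges L v, snd s + 1))"

definition loop_result ::
    "nat \<Rightarrow> sandpile \<Rightarrow> vertex set \<Rightarrow> edges \<Rightarrow> nat \<Rightarrow> bool" where
  "loop_result L \<eta> A E w' \<longleftrightarrow>
     (loop_step L \<eta> A)\<^sup>*\<^sup>* (loop_init L A) (E, w') \<and> selectable L \<eta> A E = {}"

definition recursive_args :: "vertex set \<Rightarrow> sandpile \<Rightarrow> vertex set set" where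
  "recursive_args A \<eta>' = lattice_components {v \<in> A. \<eta>' v = 3}"

text \<open>
  Termination under every sequence of choices: no sequence of choices keeps the loop running
  forever, and, whatever the choices in the loop were, each recursive call then made again
  terminates under every sequence of choices. As this is a least fixed point, infinitely deep
  recursion is excluded.
\<close>
inductive alg_terminates :: "nat \<Rightarrow> sandpile \<Rightarrow> vertex set \<Rightarrow> bool" for L where
  "\<not> (\<exists>s. s 0 = loop_init L A \<and> (\<forall>n::nat. loop_step L \<eta> A (s n) (s (Suc n)))) \<Longrightarrow>
   (\<And>E w' a. loop_result L \<eta> A E w' \<Longrightarrow> a \<in> recursive_args A (current L \<eta> E) \<Longrightarrow>
      alg_terminates L (current L \<eta> E) a) \<Longrightarrow>
   alg_terminates L \<eta> A"

text \<open>
  \<open>alg_output L \<eta> A w\<close>: some run of the algorithm on \<open>(\<eta>, A)\<close> outputs \<open>w\<close>. Without recursive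
  calls the sum is empty and the output is \<open>w'\<close>.
\<close>
inductive alg_output :: "nat \<Rightarrow> sandpile \<Rightarrow> vertex set \<Rightarrow> real \<Rightarrow> bool" for L where
  "loop_result L \<eta> A E w' \<Longrightarrow>
   \<eta>' = current L \<eta> E \<Longrightarrow>
   (\<forall>a\<in>recursive_args A \<eta>'. alg_output L \<eta>' a (z a)) \<Longrightarrow>
   alg_output L \<eta> A
     (real w' + (\<Sum>a\<in>recursive_args A \<eta>'. real (card a) / real (card A) * z a))"

end

theory Submission
  imports Defs
begin

text \<open>
  Put a grain on a vertex \<open>v\<close> of a connected set \<open>A\<close> of critical vertices. Toppling \<open>v\<close> makes its
  neighbours in \<open>A\<close> unstable, and so on, so that by connectedness every vertex of \<open>A\<close> can legally
  topple once, starting with \<open>v\<close>. The loop of the algorithm continues this with legal topplings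
  outside \<open>A\<close>. No vertex topples twice in it, because a vertex that has toppled once and has
  received at most one grain from each neighbour holds at most \<open>3 - 4 + 4\<close> grains. Hence the loop
  stops. The set of vertices that topple does not depend on the landing vertex \<open>v \<in> A\<close>; only the
  order within \<open>A\<close> does. So, with \<open>\<eta>'\<close> the sandpile computed after the loop, \<open>w'\<close> legal topplings
  lead from \<open>\<eta> + 1\<^sub>v\<close> to \<open>\<eta>' + 1\<^sub>v\<close> for every \<open>v \<in> A\<close> (lemma \<open>loop_invariant\<close>).

  Now \<open>\<eta>'\<close> is at most \<open>3\<close> everywhere, so \<open>\<eta>' + 1\<^sub>v\<close> is stable unless \<open>\<eta>' v = 3\<close>, and in that case
  \<open>\<eta>'\<close> is itself a stable sandpile in which \<open>v\<close> is critical. As the number of topplings in an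
  avalanche does not depend on their order (lemma \<open>legal_toppling_diamond\<close>), the avalanche from
  \<open>v\<close> has size \<open>w'\<close> in the first case and \<open>w'\<close> plus the avalanche size for \<open>(\<eta>', v)\<close> in the second
  (lemma \<open>avalanche_size_after_loop\<close>). Averaging over \<open>v \<in> A\<close> and grouping the vertices with
  \<open>\<eta>' v = 3\<close> by components gives precisely the recursion of the algorithm.

  The recursive sets need not shrink and need not be generators of \<open>\<eta>'\<close>, so the induction is
  about arbitrary connected critical sets and runs over a potential of the sandpile: a sum of the
  grains weighted by a positive, strictly superharmonic function, which every toppling decreases.
\<close>

section \<open>Topplings\<close>

lemma finite_grid [simp]: "finite (grid L)"
  by (simp add: grid_def)

lemma finite_subset_grid: "T \<subseteq> grid L \<Longrightarrow> finite T"
  by (rule finite_subset[OF _ finite_grid])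

lemma finite_nbrs [simp]: "finite (nbrs v)"
  by (cases v) (simp add: nbrs_def)

lemma card_nbrs: "card (nbrs v) = 4"
  by (cases v) (simp add: nbrs_def)

lemma nbrs_sym: "w \<in> nbrs v \<longleftrightarrow> v \<in> nbrs w"
  by (cases v, cases w) (auto simp: nbrs_def)

lemma not_in_own_nbrs [simp]: "v \<notin> nbrs v"
  by (cases v) (simp add: nbrs_def)

lemma topple_add_grain: "topple L u (add_grain v \<eta>) = add_grain v (topple L u \<eta>)"
  by (rule ext) (simp add: topple_def add_grain_def)

lemma topple_commute: "topple L u (topple L v \<eta>) = topple L v (topple L u \<eta>)"
  by (rule ext) (auto simp: topple_def)

lemma legal_toppling_nonneg:
  assumes "legal_toppling L \<eta> \<eta>'" "\<forall>v\<in>grid L. 0 \<le> \<eta> v"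
  shows "\<forall>v\<in>grid L. 0 \<le> \<eta>' v"
  using assms by (auto simp: legal_toppling_def topple_def)

lemma legal_topplings_nonneg:
  assumes "(legal_toppling L ^^ n) \<eta> \<eta>'" "\<forall>v\<in>grid L. 0 \<le> \<eta> v"
  shows "\<forall>v\<in>grid L. 0 \<le> \<eta>' v"
  using assms
proof (induction n arbitrary: \<eta>')
  case (Suc n)
  then show ?case by (auto dest: legal_toppling_nonneg)
qed simp

text \<open>
  Toppling one vertex only adds grains to the others and so leaves another unstable vertex
  unstable; hence two legal topplings at different vertices can be performed in either order.
\<close>
lemma legal_toppling_diamond:
  assumes "legal_toppling L \<eta> \<zeta>" "legal_toppling L \<eta> \<xi>"
  shows "\<zeta> = \<xi> \<or> (\<exists>\<theta>. legal_toppling L \<zeta> \<theta> \<and> legal_toppling L \<xi> \<theta>)"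
proof -
  obtain u v where u: "u \<in> grid L" "\<eta> u > 3" "\<zeta> = topple L u \<eta>"
    and v: "v \<in> grid L" "\<eta> v > 3" "\<xi> = topple L v \<eta>"
    using assms by (auto simp: legal_toppling_def)
  show ?thesis
  proof (cases "u = v")
    case False
    then have "topple L u \<eta> v > 3" "topple L v \<eta> u > 3"
      using u v by (auto simp: topple_def)
    then have "legal_toppling L \<zeta> (topple L v \<zeta>)" "legal_toppling L \<xi> (topple L u \<xi>)"
      using u v by (auto simp: legal_toppling_def)
    then show ?thesis
      using u v by (auto simp: topple_commute)
  qed (use u v in simp)
qed

text \<open>
  In a relation with the one-step diamond property, all reductions from a point to a normal form
  have the same length. The reason is that any other first step can be completed to a reduction
  exactly as long as the given one, which is what the induction below provides.
\<close>
lemma diamond_shorten: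
  assumes diamond: "\<And>a b c. r a b \<Longrightarrow> r a c \<Longrightarrow> b = c \<or> (\<exists>d. r b d \<and> r c d)"
    and "(r ^^ n) a x" "\<And>y. \<not> r x y" "r a c"
  shows "\<exists>k. n = Suc k \<and> (r ^^ k) c x"
  using assms(2,4)
proof (induction n arbitrary: a c)
  case 0
  then show ?case using assms(3) by auto
next
  case (Suc n)
  then obtain b where b: "r a b" "(r ^^ n) b x"
    by (blast dest: relpowp_Suc_D2)
  show ?case
  proof (cases "b = c")
    case False
    then obtain d where d: "r b d" "r c d"
      using diamond b(1) Suc.prems(2) by blast
    then obtain k where "n = Suc k" "(r ^^ k) d x"
      using Suc.IH b(2) by blast
    then show ?thesis
      using d(2) relpowp_Suc_I2 by metis
  qed (use b in auto)
qed

lemma diamond_length_unique: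
  assumes diamond: "\<And>a b c. r a b \<Longrightarrow> r a c \<Longrightarrow> b = c \<or> (\<exists>d. r b d \<and> r c d)"
    and "(r ^^ n) a x" "\<And>y. \<not> r x y" "(r ^^ m) a z" "\<And>y. \<not> r z y"
  shows "n = m"
  using assms(2,4)
proof (induction n arbitrary: a m)
  case 0
  then show ?case using assms(3) relpowp_Suc_D2[of _ r x z] by (cases m) force+
next
  case (Suc n)
  then obtain b where b: "r a b" "(r ^^ n) b x"
    by (blast dest: relpowp_Suc_D2)
  have "\<exists>k. m = Suc k \<and> (r ^^ k) b z"
    using diamond Suc.prems(2) assms(5) b(1) by (rule diamond_shorten)
  then obtain k where "m = Suc k" "(r ^^ k) b z" by blast
  then show ?case using Suc.IH b(2) by blast
qed

lemma stable_no_legal_toppling: "\<eta> \<in> stable_sandpiles L \<Longrightarrow> \<not> legal_toppling L \<eta> \<zeta>"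
  by (force simp: stable_sandpiles_def legal_toppling_def)

lemma avalanche_size_eqI:
  assumes "(legal_toppling L ^^ n) (add_grain v \<eta>) \<zeta>" "\<zeta> \<in> stable_sandpiles L"
  shows "avalanche_size L \<eta> v = n"
  unfolding avalanche_size_def
proof (rule the_equality)
  show "\<exists>\<zeta>\<in>stable_sandpiles L. (legal_toppling L ^^ n) (add_grain v \<eta>) \<zeta>"
    using assms by blast
next
  fix m
  assume "\<exists>\<zeta>\<in>stable_sandpiles L. (legal_toppling L ^^ m) (add_grain v \<eta>) \<zeta>"
  then obtain \<xi> where "\<xi> \<in> stable_sandpiles L" "(legal_toppling L ^^ m) (add_grain v \<eta>) \<xi>"
    by blast
  then show "m = n"
    using assms stable_no_legal_toppling
    by (intro diamond_length_unique[of "legal_toppling L" m _ \<xi> n \<zeta>] legal_toppling_diamond)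
qed

section \<open>A potential that decreases under toppling\<close>

text \<open>
  The weight \<open>i * (L + 1 - i)\<close> of a vertex \<open>(i, j)\<close> has discrete Laplacian \<open>-2\<close>. It is positive on
  the grid and nonnegative at all lattice neighbours of the grid, so grains lost to the sink can
  only lower the potential further.
\<close>
definition potential :: "nat \<Rightarrow> sandpile \<Rightarrow> int" where
  "potential L \<eta> = (\<Sum>v\<in>grid L. \<eta> v * (fst v * (int L + 1 - fst v)))"

lemma potential_nonneg: "\<forall>v\<in>grid L. 0 \<le> \<eta> v \<Longrightarrow> 0 \<le> potential L \<eta>"
  unfolding potential_def by (rule sum_nonneg) (auto simp: grid_def)

lemma potential_topple:
  assumes "u \<in> grid L"
  shows "potential L (topple L u \<eta>) < potential L \<eta>"
proof -
  define h :: "vertex \<Rightarrow> int" where "h v = fst v * (int L + 1 - fst v)" for v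
  have potential: "potential L \<xi> = (\<Sum>w\<in>grid L. \<xi> w * h w)" for \<xi>
    by (simp add: potential_def h_def)
  obtain i j where ij: "u = (i, j)" by (cases u)
  have "potential L (topple L u \<eta>)
      = (\<Sum>w\<in>grid L. \<eta> w * h w + (if w \<in> nbrs u then h w else 0) - (if w = u then 4 * h u else 0))"
    unfolding potential
    by (rule sum.cong) (auto simp: topple_def algebra_simps)
  also have "\<dots> = potential L \<eta> + (\<Sum>w\<in>grid L \<inter> nbrs u. h w) - 4 * h u"
    using assms
    by (simp add: sum.distrib sum_subtractf potential sum.inter_restrict)
  also have "(\<Sum>w\<in>grid L \<inter> nbrs u. h w) \<le> (\<Sum>w\<in>nbrs u. h w)"
  proof (rule sum_mono2)
    show "0 \<le> h w" if "w \<in> nbrs u - grid L \<inter> nbrs u" for w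
      using that assms by (auto simp: h_def nbrs_def grid_def ij)
  qed auto
  also have "(\<Sum>w\<in>nbrs u. h w) = 4 * h u - 2"
    by (simp add: nbrs_def ij h_def algebra_simps)
  finally show ?thesis by simp
qed

lemma potential_legal_topplings:
  assumes "(legal_toppling L ^^ n) \<eta> \<zeta>"
  shows "potential L \<zeta> \<le> potential L \<eta> - int n"
  using assms
proof (induction n arbitrary: \<zeta>)
  case (Suc n)
  then obtain \<xi> where \<xi>: "(legal_toppling L ^^ n) \<eta> \<xi>" "legal_toppling L \<xi> \<zeta>"
    by auto
  then obtain u where "u \<in> grid L" "\<zeta> = topple L u \<xi>"
    by (auto simp: legal_toppling_def)
  then have "potential L \<zeta> < potential L \<xi>"
    using potential_topple by simp
  then show ?case using Suc.IH[OF \<xi>(1)] by simp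
qed simp

lemma stabilization_exists:
  assumes "\<forall>v\<in>grid L. 0 \<le> \<eta> v"
  shows "\<exists>n. \<exists>\<zeta>\<in>stable_sandpiles L. (legal_toppling L ^^ n) \<eta> \<zeta>"
  using assms
proof (induction "nat (potential L \<eta>)" arbitrary: \<eta> rule: less_induct)
  case less
  show ?case
  proof (cases "\<eta> \<in> stable_sandpiles L")
    case True
    then have "(legal_toppling L ^^ 0) \<eta> \<eta>" by simp
    then show ?thesis using True by blast
  next
    case False
    then obtain u where u: "u \<in> grid L" "\<eta> u > 3"
      using less.prems by (force simp: stable_sandpiles_def)
    then have step: "legal_toppling L \<eta> (topple L u \<eta>)"
      by (auto simp: legal_toppling_def)
    have "nat (potential L (topple L u \<eta>)) < nat (potential L \<eta>)"
      using potential_topple[OF u(1), of \<eta>]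
        potential_nonneg[OF legal_toppling_nonneg[OF step less.prems]] by simp
    then obtain n \<zeta> where "\<zeta> \<in> stable_sandpiles L" "(legal_toppling L ^^ n) (topple L u \<eta>) \<zeta>"
      using less.hyps legal_toppling_nonneg[OF step less.prems] by blast
    then show ?thesis using step relpowp_Suc_I2 by metis
  qed
qed

section \<open>The loop as a sequence of legal topplings\<close>

lemma indeg_out_edges:
  "indeg (out_edges L u) w = (if w \<in> grid L \<inter> nbrs u then 1 else 0)"
proof -
  have "{x \<in> nbrs u. (if x \<in> grid L then Some x else None) = Some w} =
      (if w \<in> grid L \<inter> nbrs u then {w} else {})"
    by auto
  then show ?thesis
    by (simp add: indeg_def out_edges_def filter_mset_image_mset)
qed

lemma outdeg_out_edges: "outdeg (out_edges L u) w = (if w = u then 4 else 0)"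
  by (simp add: outdeg_def out_edges_def filter_mset_image_mset card_nbrs)

lemma current_empty [simp]: "current L \<eta> {#} = \<eta>"
  by (rule ext) (simp add: current_def indeg_def outdeg_def)

lemma current_add_out_edges:
  assumes "u \<in> grid L"
  shows "current L \<eta> (E + out_edges L u) = topple L u (current L \<eta> E)"
proof
  fix w
  have "indeg (E + out_edges L u) w = indeg E w + indeg (out_edges L u) w"
    "outdeg (E + out_edges L u) w = outdeg E w + outdeg (out_edges L u) w"
    by (simp_all add: indeg_def outdeg_def)
  then show "current L \<eta> (E + out_edges L u) w = topple L u (current L \<eta> E) w"
    using assms by (auto simp: current_def topple_def indeg_out_edges outdeg_out_edges)
qed

text \<open>
  Defining this through edges makes it literally what the loop computes, and independent of an
  order of toppling.
\<close>
definition topple_each :: "nat \<Rightarrow> vertex set \<Rightarrow> sandpile \<Rightarrow> sandpile" where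
  "topple_each L T \<eta> = current L \<eta> (\<Sum>v\<in>T. out_edges L v)"

lemma topple_each_insert:
  assumes "finite T" "u \<in> grid L" "u \<notin> T"
  shows "topple_each L (insert u T) \<eta> = topple L u (topple_each L T \<eta>)"
  using assms current_add_out_edges[of u L \<eta> "\<Sum>v\<in>T. out_edges L v"]
  by (simp add: topple_each_def add.commute)

lemma topple_each_apply:
  assumes "T \<subseteq> grid L" "w \<in> grid L"
  shows "topple_each L T \<eta> w = \<eta> w + int (card (nbrs w \<inter> T)) - (if w \<in> T then 4 else 0)"
proof -
  have "finite T" using assms(1) by (rule finite_subset_grid)
  then show ?thesis using assms(1)
  proof (induction T rule: finite_induct)
    case empty
    then show ?case by (simp add: topple_each_def)
  next
    case (insert u T)
    have "nbrs w \<inter> insert u T = (if w \<in> nbrs u then insert u (nbrs w \<inter> T) else nbrs w \<inter> T)"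
      using nbrs_sym by auto
    then show ?case
      using insert assms(2)
      by (auto simp: topple_each_insert topple_def)
  qed
qed

text \<open>
  A vertex loses four grains and regains at most one from each of its four neighbours.
\<close>
lemma topple_each_le:
  assumes "T \<subseteq> grid L" "w \<in> T"
  shows "topple_each L T \<eta> w \<le> \<eta> w"
proof -
  have "card (nbrs w \<inter> T) \<le> 4"
    using card_mono[of "nbrs w" "nbrs w \<inter> T"] by (simp add: card_nbrs)
  then show ?thesis using assms by (subst topple_each_apply) auto
qed

lemma legal_toppling_topple_each:
  assumes "finite T" "u \<in> grid L" "u \<notin> T" "add_grain v (topple_each L T \<eta>) u > 3"
  shows "legal_toppling L (add_grain v (topple_each L T \<eta>))
           (add_grain v (topple_each L (insert u T) \<eta>))"
  using assms by (auto simp: legal_toppling_def topple_each_insert topple_add_grain)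

lemma lattice_connected_exit:
  assumes "lattice_connected A" "v \<in> S" "S \<subset> A"
  shows "\<exists>x\<in>S. \<exists>u\<in>A - S. u \<in> nbrs x"
proof (rule ccontr)
  assume no: "\<not> ?thesis"
  obtain t where t: "t \<in> A" "t \<notin> S" using assms(3) by auto
  have "(\<lambda>x y. x \<in> A \<and> y \<in> A \<and> y \<in> nbrs x)\<^sup>*\<^sup>* v t"
    using assms t(1) by (auto simp: lattice_connected_def)
  then have "t \<in> S"
    by (induction rule: rtranclp_induct) (use no assms(2) in auto)
  then show False using t(2) by simp
qed

text \<open>
  As long as only part of a connected critical set has toppled, some vertex of the rest is
  adjacent to that part and has become unstable.
\<close>
lemma legal_topplings_connected_critical:
  assumes "lattice_connected A" "A \<subseteq> grid L" "\<forall>u\<in>A. \<eta> u = 3" "v \<in> A"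
  shows "(legal_toppling L ^^ card A) (add_grain v \<eta>) (add_grain v (topple_each L A \<eta>))"
proof -
  have fin: "finite A" using assms(2) by (rule finite_subset_grid)
  have "\<exists>S\<subseteq>A. v \<in> S \<and> card S = Suc n \<and>
      (legal_toppling L ^^ Suc n) (add_grain v \<eta>) (add_grain v (topple_each L S \<eta>))"
    if "Suc n \<le> card A" for n
    using that
  proof (induction n)
    case 0
    have "legal_toppling L (add_grain v (topple_each L {} \<eta>))
        (add_grain v (topple_each L (insert v {}) \<eta>))"
      using assms by (intro legal_toppling_topple_each) (auto simp: topple_each_def add_grain_def)
    then show ?case
      using assms(4) by (intro exI[of _ "{v}"]) (auto simp: topple_each_def)
  next
    case (Suc n)
    then obtain S where S: "S \<subseteq> A" "v \<in> S" "card S = Suc n"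
      "(legal_toppling L ^^ Suc n) (add_grain v \<eta>) (add_grain v (topple_each L S \<eta>))"
      by auto
    then have "S \<subset> A" using Suc.prems by auto
    then obtain x u where xu: "x \<in> S" "u \<in> A" "u \<notin> S" "u \<in> nbrs x"
      using lattice_connected_exit[OF assms(1) S(2)] by blast
    have finS: "finite S" using S(1) fin finite_subset by auto
    have "nbrs u \<inter> S \<noteq> {}" using xu nbrs_sym[of u x] by blast
    then have "card (nbrs u \<inter> S) > 0" using finS by (simp add: card_gt_0_iff)
    moreover have "topple_each L S \<eta> u = \<eta> u + int (card (nbrs u \<inter> S))"
      using xu S(1) assms(2) topple_each_apply[of S L u \<eta>] by auto
    ultimately have "add_grain v (topple_each L S \<eta>) u > 3"
      using assms(3) xu by (auto simp: add_grain_def)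
    then have "legal_toppling L (add_grain v (topple_each L S \<eta>))
        (add_grain v (topple_each L (insert u S) \<eta>))"
      using xu assms(2) finS by (intro legal_toppling_topple_each) auto
    then have "(legal_toppling L ^^ Suc (Suc n)) (add_grain v \<eta>)
        (add_grain v (topple_each L (insert u S) \<eta>))"
      using S(4) relpowp_Suc_I by metis
    then show ?case
      using S xu finS by (intro exI[of _ "insert u S"]) auto
  qed
  from this[of "card A - 1"] obtain S where S: "S \<subseteq> A" "card S = card A"
      "(legal_toppling L ^^ card A) (add_grain v \<eta>) (add_grain v (topple_each L S \<eta>))"
    using assms(4) fin by (metis Suc_pred' card_gt_0_iff empty_iff order_refl)
  then show ?thesis using card_subset_eq[OF fin] by auto
qed

text \<open>
  The class of inputs on which the algorithm recurses. The set is not required to be a whole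
  component of the critical vertices, since recursive calls do not preserve this.
\<close>
definition connected_critical :: "nat \<Rightarrow> sandpile \<Rightarrow> vertex set \<Rightarrow> bool" where
  "connected_critical L \<eta> A \<longleftrightarrow>
     \<eta> \<in> stable_sandpiles L \<and> lattice_connected A \<and> A \<subseteq> grid L \<and> (\<forall>v\<in>A. \<eta> v = 3)"

lemma connected_critical_finite: "connected_critical L \<eta> A \<Longrightarrow> finite A \<and> A \<noteq> {}"
  using finite_subset_grid by (auto simp: connected_critical_def lattice_connected_def)

text \<open>
  The set \<open>T\<close> consists of the vertices toppled so far, each exactly once: a vertex of \<open>T\<close> holds at
  most as many grains as in the stable sandpile \<open>\<eta>\<close> and hence is not selectable.
\<close>
lemma loop_invariant:
  assumes "connected_critical L \<eta> A" "(loop_step L \<eta> A)\<^sup>*\<^sup>* (loop_init L A) s"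
  shows "\<exists>T. A \<subseteq> T \<and> T \<subseteq> grid L \<and> fst s = (\<Sum>v\<in>T. out_edges L v) \<and> snd s = card T \<and>
    (\<forall>v\<in>A. (legal_toppling L ^^ snd s) (add_grain v \<eta>) (add_grain v (topple_each L T \<eta>)))"
  using assms(2)
proof (induction rule: rtranclp_induct)
  case base
  show ?case
    using assms(1) legal_topplings_connected_critical
    by (intro exI[of _ A]) (auto simp: connected_critical_def loop_init_def)
next
  case (step s s')
  then obtain T where T: "A \<subseteq> T" "T \<subseteq> grid L" "fst s = (\<Sum>v\<in>T. out_edges L v)" "snd s = card T"
    "\<forall>v\<in>A. (legal_toppling L ^^ snd s) (add_grain v \<eta>) (add_grain v (topple_each L T \<eta>))"
    by auto
  obtain u where u: "u \<in> grid L" "topple_each L T \<eta> u \<ge> 4" "s' = (fst s + out_edges L u, snd s + 1)"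
    using step.hyps(2) T(3) by (auto simp: loop_step_def selectable_def topple_each_def)
  have finT: "finite T" using T(2) by (rule finite_subset_grid)
  have "u \<notin> T"
  proof
    assume "u \<in> T"
    then have "topple_each L T \<eta> u \<le> \<eta> u" using topple_each_le T(2) by blast
    moreover have "\<eta> u < 4"
      using assms(1) u(1) by (auto simp: connected_critical_def stable_sandpiles_def)
    ultimately show False using u(2) by simp
  qed
  have "(legal_toppling L ^^ Suc (snd s)) (add_grain v \<eta>)
      (add_grain v (topple_each L (insert u T) \<eta>))" if "v \<in> A" for v
  proof (rule relpowp_Suc_I)
    show "(legal_toppling L ^^ snd s) (add_grain v \<eta>) (add_grain v (topple_each L T \<eta>))"
      using T(5) that by blast
    show "legal_toppling L (add_grain v (topple_each L T \<eta>))
        (add_grain v (topple_each L (insert u T) \<eta>))"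
      using finT u \<open>u \<notin> T\<close> by (intro legal_toppling_topple_each) (auto simp: add_grain_def)
  qed
  then show ?case
    using T u \<open>u \<notin> T\<close> finT by (intro exI[of _ "insert u T"]) (auto simp: add.commute)
qed

lemma loop_counter_le:
  assumes "connected_critical L \<eta> A" "(loop_step L \<eta> A)\<^sup>*\<^sup>* (loop_init L A) s"
  shows "snd s \<le> card (grid L)"
  using loop_invariant[OF assms] card_mono[OF finite_grid] by metis

lemma loop_terminates:
  assumes "connected_critical L \<eta> A"
  shows "\<not> (\<exists>s. s 0 = loop_init L A \<and> (\<forall>n::nat. loop_step L \<eta> A (s n) (s (Suc n))))"
proof
  assume "\<exists>s. s 0 = loop_init L A \<and> (\<forall>n::nat. loop_step L \<eta> A (s n) (s (Suc n)))"
  then obtain s where s: "s 0 = loop_init L A" "\<And>n::nat. loop_step L \<eta> A (s n) (s (Suc n))"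
    by auto
  have "(loop_step L \<eta> A)\<^sup>*\<^sup>* (loop_init L A) (s n) \<and> n \<le> snd (s n)" for n
  proof (induction n)
    case (Suc n)
    have "snd (s (Suc n)) = snd (s n) + 1"
      using s(2)[of n] by (auto simp: loop_step_def)
    moreover have "(loop_step L \<eta> A)\<^sup>*\<^sup>* (loop_init L A) (s (Suc n))"
      using Suc s(2)[of n] by (auto intro: rtranclp.rtrancl_into_rtrancl)
    ultimately show ?case using Suc by simp
  qed (simp add: s)
  from this[of "Suc (card (grid L))"] show False
    using loop_counter_le[OF assms] by fastforce
qed

text \<open>
  The counter increases with each step and is bounded, so a reachable state in which it is maximal
  has no successor.
\<close>
lemma loop_result_exists:
  assumes "connected_critical L \<eta> A"
  shows "\<exists>E w'. loop_result L \<eta> A E w'"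
proof -
  let ?reach = "(loop_step L \<eta> A)\<^sup>*\<^sup>* (loop_init L A)"
  obtain s where s: "?reach s" "\<And>t. ?reach t \<Longrightarrow> snd t \<le> snd s"
    using ex_has_greatest_nat[of ?reach "loop_init L A" snd "Suc (card (grid L))"]
      loop_counter_le[OF assms] by (auto simp: less_Suc_eq_le)
  have "selectable L \<eta> A (fst s) = {}"
  proof (rule ccontr)
    assume "selectable L \<eta> A (fst s) \<noteq> {}"
    then obtain v where "loop_step L \<eta> A s (fst s + out_edges L v, snd s + 1)"
      by (auto simp: loop_step_def)
    then have "?reach (fst s + out_edges L v, snd s + 1)"
      using s(1) by (rule rtranclp.rtrancl_into_rtrancl[rotated])
    from s(2)[OF this] show False by simp
  qed
  then have "loop_result L \<eta> A (fst s) (snd s)"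
    using s(1) by (simp add: loop_result_def)
  then show ?thesis by blast
qed

lemma loop_result_legal_topplings:
  assumes "connected_critical L \<eta> A" "loop_result L \<eta> A E w'" "v \<in> A"
  shows "(legal_toppling L ^^ w') (add_grain v \<eta>) (add_grain v (current L \<eta> E))"
    and "0 < w'"
    and "\<forall>u\<in>grid L. 0 \<le> add_grain v (current L \<eta> E) u"
    and "\<forall>u\<in>grid L. current L \<eta> E u \<le> 3"
proof -
  obtain T where T: "A \<subseteq> T" "T \<subseteq> grid L" "E = (\<Sum>v\<in>T. out_edges L v)" "w' = card T"
    "\<forall>v\<in>A. (legal_toppling L ^^ w') (add_grain v \<eta>) (add_grain v (topple_each L T \<eta>))"
    using loop_invariant[OF assms(1), of "(E, w')"] assms(2) by (auto simp: loop_result_def)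
  show *: "(legal_toppling L ^^ w') (add_grain v \<eta>) (add_grain v (current L \<eta> E))"
    using T assms(3) by (simp add: topple_each_def)
  have "finite T" using T(2) by (rule finite_subset_grid)
  then show "0 < w'" using T assms(3) by (auto simp: card_gt_0_iff)
  have stable: "0 \<le> \<eta> u \<and> \<eta> u \<le> 3" if "u \<in> grid L" for u
    using assms(1) that by (force simp: connected_critical_def stable_sandpiles_def)
  then show "\<forall>u\<in>grid L. 0 \<le> add_grain v (current L \<eta> E) u"
    by (intro legal_topplings_nonneg[OF *]) (auto simp: add_grain_def)
  show "\<forall>u\<in>grid L. current L \<eta> E u \<le> 3"
  proof
    fix u assume u: "u \<in> grid L"
    show "current L \<eta> E u \<le> 3"
    proof (cases "u \<in> A")
      case True
      then show ?thesis
        using topple_each_le[OF T(2), of u \<eta>] T(1,3) stable[OF u] by (auto simp: topple_each_def)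
    next
      case False
      then have "\<not> 4 \<le> current L \<eta> E u"
        using assms(2) u unfolding loop_result_def selectable_def by blast
      then show ?thesis by simp
    qed
  qed
qed

text \<open>
  On \<open>A\<close> the new sandpile can take the value \<open>-1\<close>, because the grain that starts the avalanche is
  missing in it. This does not happen once \<open>\<eta>' v = 3\<close> for some \<open>v \<in> A\<close>: a negative value would
  remain if the grain is added at \<open>v\<close>, but legal topplings from \<open>\<eta> + 1\<^sub>v\<close> produce no negative values.
\<close>
lemma loop_result_stable:
  assumes "connected_critical L \<eta> A" "loop_result L \<eta> A E w'" "v \<in> A" "current L \<eta> E v = 3"
  shows "current L \<eta> E \<in> stable_sandpiles L"
  using loop_result_legal_topplings(3,4)[OF assms(1-3)] assms(4)
  by (force simp: stable_sandpiles_def add_grain_def split: if_splits)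

lemma potential_add_grain:
  "v \<in> grid L \<Longrightarrow> potential L (add_grain v \<eta>) = potential L \<eta> + fst v * (int L + 1 - fst v)"
proof -
  assume v: "v \<in> grid L"
  have "potential L (add_grain v \<eta>) = (\<Sum>w\<in>grid L. \<eta> w * (fst w * (int L + 1 - fst w)) +
      (if w = v then fst v * (int L + 1 - fst v) else 0))"
    unfolding potential_def by (rule sum.cong) (auto simp: add_grain_def algebra_simps)
  then show ?thesis using v by (simp add: sum.distrib potential_def)
qed

text \<open>
  The topplings are legal only with the extra grain on \<open>v\<close>, but this grain adds the same amount to
  the potential before and after them.
\<close>
lemma loop_result_potential:
  assumes "connected_critical L \<eta> A" "loop_result L \<eta> A E w'"
  shows "potential L (current L \<eta> E) < potential L \<eta>"
proof -
  obtain v where v: "v \<in> A" "v \<in> grid L"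
    using assms(1) unfolding connected_critical_def lattice_connected_def by blast
  show ?thesis
    using potential_legal_topplings[OF loop_result_legal_topplings(1)[OF assms v(1)]]
      loop_result_legal_topplings(2)[OF assms v(1)] by (simp add: potential_add_grain v(2))
qed

lemma avalanche_size_after_loop:
  assumes "connected_critical L \<eta> A" "loop_result L \<eta> A E w'" "v \<in> A"
  shows "avalanche_size L \<eta> v =
    w' + (if current L \<eta> E v = 3 then avalanche_size L (current L \<eta> E) v else 0)"
proof (cases "current L \<eta> E v = 3")
  case True
  obtain n \<zeta> where n: "\<zeta> \<in> stable_sandpiles L"
    "(legal_toppling L ^^ n) (add_grain v (current L \<eta> E)) \<zeta>"
    using stabilization_exists[OF loop_result_legal_topplings(3)[OF assms]] by blast
  then have "(legal_toppling L ^^ (w' + n)) (add_grain v \<eta>) \<zeta>"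
    using loop_result_legal_topplings(1)[OF assms] by (auto simp: relpowp_add)
  then show ?thesis
    using n True avalanche_size_eqI by simp
next
  case False
  have "v \<in> grid L" using assms by (auto simp: connected_critical_def)
  then have "add_grain v (current L \<eta> E) \<in> stable_sandpiles L"
    using loop_result_legal_topplings(3,4)[OF assms] False
    by (force simp: stable_sandpiles_def add_grain_def)
  then show ?thesis
    using loop_result_legal_topplings(1)[OF assms] False avalanche_size_eqI by simp
qed

section \<open>Connected components\<close>

lemma lattice_connected_Un:
  assumes "lattice_connected C" "lattice_connected D" "p \<in> C \<inter> D"
  shows "lattice_connected (C \<union> D)"
  unfolding lattice_connected_def
proof (intro conjI ballI)
  let ?R = "\<lambda>S x y. x \<in> S \<and> y \<in> S \<and> y \<in> nbrs x"
  have path: "(?R (C \<union> D))\<^sup>*\<^sup>* x y" if "x \<in> C \<and> y \<in> C \<or> x \<in> D \<and> y \<in> D" for x y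
  proof -
    have "(?R C)\<^sup>*\<^sup>* x y \<or> (?R D)\<^sup>*\<^sup>* x y"
      using that assms by (auto simp: lattice_connected_def)
    then show ?thesis
      by (auto elim!: rtranclp_mono[THEN predicate2D, rotated])
  qed
  fix u v assume "u \<in> C \<union> D" "v \<in> C \<union> D"
  then have "(?R (C \<union> D))\<^sup>*\<^sup>* u p" "(?R (C \<union> D))\<^sup>*\<^sup>* p v"
    using assms(3) path by blast+
  then show "(?R (C \<union> D))\<^sup>*\<^sup>* u v" by (rule rtranclp_trans)
qed (use assms(3) in auto)

lemma lattice_components_disjoint:
  assumes "C \<in> lattice_components S" "D \<in> lattice_components S" "C \<noteq> D"
  shows "C \<inter> D = {}"
proof (rule ccontr)
  assume "C \<inter> D \<noteq> {}"
  then obtain p where "p \<in> C \<inter> D" by auto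
  moreover have C: "C \<subseteq> S" "lattice_connected C"
      "\<And>X. X \<subseteq> S \<and> lattice_connected X \<and> C \<subseteq> X \<Longrightarrow> X = C"
    using assms(1) by (simp_all add: lattice_components_def)
  moreover have D: "D \<subseteq> S" "lattice_connected D"
      "\<And>X. X \<subseteq> S \<and> lattice_connected X \<and> D \<subseteq> X \<Longrightarrow> X = D"
    using assms(2) by (simp_all add: lattice_components_def)
  ultimately have conn: "lattice_connected (C \<union> D)"
    using lattice_connected_Un by metis
  have "C \<union> D = C" by (rule C(3)) (simp add: conn C(1) D(1))
  moreover have "C \<union> D = D" by (rule D(3)) (simp add: conn C(1) D(1))
  ultimately show False using assms(3) by simp
qed

lemma Union_lattice_components:
  assumes "finite S"
  shows "\<Union> (lattice_components S) = S"
proof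
  show "\<Union> (lattice_components S) \<subseteq> S" by (auto simp: lattice_components_def)
  show "S \<subseteq> \<Union> (lattice_components S)"
  proof
    fix v assume "v \<in> S"
    let ?F = "{C. C \<subseteq> S \<and> lattice_connected C}"
    have "finite ?F" using assms by (auto intro: finite_subset[of _ "Pow S"])
    moreover have "{v} \<in> ?F" using \<open>v \<in> S\<close> by (auto simp: lattice_connected_def)
    ultimately obtain C where "C \<in> ?F" "{v} \<subseteq> C" "\<forall>D\<in>?F. C \<subseteq> D \<longrightarrow> C = D"
      by (rule finite_has_maximal2[of ?F "{v}", THEN bexE]) auto
    then have "C \<in> lattice_components S" "v \<in> C" by (auto simp: lattice_components_def)
    then show "v \<in> \<Union> (lattice_components S)" by blast
  qed
qed

lemma sum_lattice_components:
  fixes f :: "vertex \<Rightarrow> 'a :: comm_monoid_add"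
  assumes "finite S"
  shows "sum f S = (\<Sum>C\<in>lattice_components S. sum f C)"
proof -
  have "sum f (\<Union> (lattice_components S)) = (sum \<circ> sum) f (lattice_components S)"
  proof (rule sum.Union_disjoint)
    show "\<forall>C\<in>lattice_components S. finite C"
      using assms finite_subset by (auto simp: lattice_components_def)
  qed (use lattice_components_disjoint in blast)
  then show ?thesis by (simp add: Union_lattice_components[OF assms])
qed

section \<open>The recursion\<close>

lemma cond_pmf_of_set_subset:
  assumes "finite S" "B \<subseteq> S" "B \<noteq> {}"
  shows "cond_pmf (pmf_of_set S) B = pmf_of_set B"
proof (rule pmf_eqI)
  fix x
  have "finite B" "S \<noteq> {}" "S \<inter> B = B" using assms finite_subset by auto
  then show "pmf (cond_pmf (pmf_of_set S) B) x = pmf (pmf_of_set B) x"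
    using assms by (auto simp: pmf_cond measure_pmf_of_set indicator_def)
qed

lemma expected_avalanche_size_sum:
  assumes "B \<subseteq> grid L" "B \<noteq> {}"
  shows "real (card B) * expected_avalanche_size L \<eta> B = (\<Sum>v\<in>B. real (avalanche_size L \<eta> v))"
proof -
  have "finite B"
    using assms(1) by (rule finite_subset_grid)
  then have "expected_avalanche_size L \<eta> B = (\<Sum>v\<in>B. real (avalanche_size L \<eta> v)) / real (card B)"
    using assms
    by (simp add: expected_avalanche_size_def cond_pmf_of_set_subset integral_pmf_of_set)
  then show ?thesis using assms(2) \<open>finite B\<close> by simp
qed

lemma recursive_args_connected_critical:
  assumes "connected_critical L \<eta> A" "loop_result L \<eta> A E w'"
    "a \<in> recursive_args A (current L \<eta> E)"
  shows "connected_critical L (current L \<eta> E) a"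
proof -
  have a: "lattice_connected a" "a \<subseteq> {v \<in> A. current L \<eta> E v = 3}"
    using assms(3) by (auto simp: recursive_args_def lattice_components_def)
  then obtain v where "v \<in> A" "current L \<eta> E v = 3"
    by (auto simp: lattice_connected_def)
  then show ?thesis
    using a assms(1) loop_result_stable[OF assms(1,2)] by (auto simp: connected_critical_def)
qed

text \<open>
  The output rule of the algorithm, satisfied by the expectation: the sum of the avalanche sizes
  over the vertices of \<open>A\<close> that are critical after the loop splits over their components, and on a
  component \<open>a\<close> it is \<open>card a\<close> times an average.
\<close>
lemma expected_avalanche_size_recursion:
  assumes "connected_critical L \<eta> A" "loop_result L \<eta> A E w'"
  shows "expected_avalanche_size L \<eta> A = real w' +
    (\<Sum>a\<in>recursive_args A (current L \<eta> E).
       real (card a) / real (card A) * expected_avalanche_size L (current L \<eta> E) a)"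
proof -
  let ?\<eta>' = "current L \<eta> E"
  have A: "finite A" "A \<noteq> {}" "A \<subseteq> grid L"
    using connected_critical_finite assms(1) by (auto simp: connected_critical_def)
  have "real (card A) * expected_avalanche_size L \<eta> A = (\<Sum>v\<in>A. real (avalanche_size L \<eta> v))"
    using A by (simp add: expected_avalanche_size_sum)
  also have "\<dots> = (\<Sum>v\<in>A. real w' + (if ?\<eta>' v = 3 then real (avalanche_size L ?\<eta>' v) else 0))"
    using avalanche_size_after_loop[OF assms] by (intro sum.cong) auto
  also have "\<dots> = real (card A) * real w' +
      (\<Sum>v\<in>{v \<in> A. ?\<eta>' v = 3}. real (avalanche_size L ?\<eta>' v))"
    using A by (simp add: sum.distrib sum.inter_filter)
  also have "(\<Sum>v\<in>{v \<in> A. ?\<eta>' v = 3}. real (avalanche_size L ?\<eta>' v)) =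
      (\<Sum>a\<in>recursive_args A ?\<eta>'. \<Sum>v\<in>a. real (avalanche_size L ?\<eta>' v))"
    using A unfolding recursive_args_def by (intro sum_lattice_components) auto
  also have "\<dots> = (\<Sum>a\<in>recursive_args A ?\<eta>'. real (card a) * expected_avalanche_size L ?\<eta>' a)"
  proof (rule sum.cong)
    fix a assume "a \<in> recursive_args A ?\<eta>'"
    then have "connected_critical L ?\<eta>' a"
      using recursive_args_connected_critical[OF assms] by blast
    then show "(\<Sum>v\<in>a. real (avalanche_size L ?\<eta>' v)) =
        real (card a) * expected_avalanche_size L ?\<eta>' a"
      using connected_critical_finite expected_avalanche_size_sum
      by (metis connected_critical_def)
  qed simp
  finally have "expected_avalanche_size L \<eta> A = real w' +
      (\<Sum>a\<in>recursive_args A ?\<eta>'. real (card a) * expected_avalanche_size L ?\<eta>' a) / real (card A)"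
    using A by (simp add: field_simps)
  then show ?thesis by (simp add: sum_divide_distrib)
qed

lemma alg_correct:
  assumes "connected_critical L \<eta> A"
  shows "alg_terminates L \<eta> A \<and> (\<forall>w. alg_output L \<eta> A w \<longleftrightarrow> w = expected_avalanche_size L \<eta> A)"
  using assms
proof (induction "nat (potential L \<eta>)" arbitrary: \<eta> A rule: less_induct)
  case less
  have IH: "alg_terminates L (current L \<eta> E) a"
    "alg_output L (current L \<eta> E) a z \<longleftrightarrow> z = expected_avalanche_size L (current L \<eta> E) a"
    if "loop_result L \<eta> A E w'" "a \<in> recursive_args A (current L \<eta> E)" for E w' a z
  proof -
    have a: "connected_critical L (current L \<eta> E) a"
      using recursive_args_connected_critical less.prems that by blast
    then have "0 \<le> potential L (current L \<eta> E)"
      by (intro potential_nonneg) (auto simp: connected_critical_def stable_sandpiles_def)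
    then have "nat (potential L (current L \<eta> E)) < nat (potential L \<eta>)"
      using loop_result_potential[OF less.prems that(1)] by simp
    then show "alg_terminates L (current L \<eta> E) a"
      "alg_output L (current L \<eta> E) a z \<longleftrightarrow> z = expected_avalanche_size L (current L \<eta> E) a"
      using less.hyps a by blast+
  qed
  have "alg_terminates L \<eta> A"
    using loop_terminates[OF less.prems] IH(1) by (rule alg_terminates.intros)
  moreover have "w = expected_avalanche_size L \<eta> A" if "alg_output L \<eta> A w" for w
    using that
  proof cases
    case (1 E w' \<eta>' z)
    then have "z a = expected_avalanche_size L \<eta>' a" if "a \<in> recursive_args A \<eta>'" for a
      using IH(2) that by blast
    then show ?thesis
      using 1 expected_avalanche_size_recursion[OF less.prems] by simp
  qed
  moreover have "alg_output L \<eta> A (expected_avalanche_size L \<eta> A)"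
  proof -
    obtain E w' where E: "loop_result L \<eta> A E w'"
      using loop_result_exists[OF less.prems] by blast
    show ?thesis
      unfolding expected_avalanche_size_recursion[OF less.prems E]
      using IH(2)[OF E] by (intro alg_output.intros(1)[OF E refl] ballI) simp
  qed
  ultimately show ?case by blast
qed

theorem theorem3p3:
  fixes L :: nat and \<eta> :: sandpile and A :: "vertex set"
  assumes "L \<ge> 1"
    and "\<eta> \<in> stable_sandpiles L"
    and "A \<in> generators L \<eta>"
  shows "alg_terminates L \<eta> A \<and>
         (\<forall>w. alg_output L \<eta> A w \<longleftrightarrow> w = expected_avalanche_size L \<eta> A)"
proof (rule alg_correct)
  show "connected_critical L \<eta> A"
    using assms(2,3)
    by (auto simp: connected_critical_def generators_def lattice_components_def critical_def)
qed

end
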